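(* Let $k=2$ and let $\mathbf{T}(f)$ be a complex symmetric tridiagonal $2$-Toeplitz operator whose symbol $f(z)\in\mathbb{C}^{2\times2}$ is persymmetric. If $\lambda=a_1$ (the unique element of $\sigma(\mathbf{B}_0)$) is an edge eigenvalue of $\mathbf{T}(f)$, then it is topologically protected.
   Context: Let $a_1,a_2\in\mathbb{C}$ and $b_1,b_2\in\mathbb{C}\setminus\{0\}$, extended $2$-periodically in the index. The symmetric (not necessarily Hermitian) tridiagonal $2$-Toeplitz operator $\mathbf{T}(f)$ on $\ell^2(\mathbb{N})$, $\mathbb{N}=\{1,2,\dots\}$, has matrix entries $\mathbf{T}(f)_{n,n}=a_n$, $\mathbf{T}(f)_{n,n+1}=\mathbf{T}(f)_{n+1,n}=b_n$, and all other entries zero. Its symbol is $$f(z)=\begin{pmatrix}a_1&b_1+b_2z\\ b_1+b_2z^{-1}&a_2\end{pmatrix}.$$ $\mathbf{B}_0=(a_1)$ is the leading $1\times1$ principal submatrix. $\sigma_{\mathrm{ess}}$ denotes the essential spectrum; $\sigma_{\mathrm{ess}}(\mathbf{T}(f))=\bigcup_{z\in\mathbb{T}}\sigma(f(z))$, with $\mathbb{T}$ the unit circle. The symbol is persymmetric (local inversion symmetry) if $f(z)=\mathbf{J}f(z)^\top\mathbf{J}$ with $\mathbf{J}=\begin{pmatrix}0&1\\1&0\end{pmatrix}$, i.e. $a_1=a_2$. A number $\lambda\in\mathbb{C}\setminus\sigma_{\mathrm{ess}}(\mathbf{T}(f))$ is an edge eigenvalue of $\mathbf{T}(f)$ if there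 is a nonzero $\mathbf{v}\in\ell^2(\mathbb{N})$, exponentially decaying, with $\mathbf{T}(f)\mathbf{v}=\lambda\mathbf{v}$. The band gap of $f$ is said to close if $f(z)$ has an eigenvalue of multiplicity $2$ for some $z\in\mathbb{T}$. Topological protection: the edge eigenvalue is robust under continuous perturbations of the symbol that preserve persymmetry, as long as the band gap does not close. Precisely: for every family $(f_t)_{t\in[0,1]}$ of persymmetric symbols of complex symmetric tridiagonal $2$-Toeplitz operators with parameters $a_1(t)=a_2(t)\in\mathbb{C}$, $b_1(t),b_2(t)\in\mathbb{C}\setminus\{0\}$ depending continuously on $t$, with $f_0=f$, and such that the band gap of $f_t$ does not close for any $t\in[0,1]$, one has $a_1(t)\notin\sigma_{\mathrm{ess}}(\mathbf{T}(f_t))$ and $a_1(t)$ is an edge eigenvalue of $\mathbf{T}(f_t)$ for all $t\in[0,1]$. *)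

theory Defs
  imports
    Complex_Main
    "HOL-Library.Function_Algebras"
    "Jordan_Normal_Form.Char_Poly"
begin

text \<open>Sequences indexed by \<open>{1, 2, \<dots>}\<close> are modelled as functions on \<open>nat\<close>, shifted by one:
  position \<open>n\<close> here is position \<open>n + 1\<close> in the usual numbering. Addition and subtraction of
  sequences are pointwise.\<close>

definition cscale :: "complex \<Rightarrow> (nat \<Rightarrow> complex) \<Rightarrow> (nat \<Rightarrow> complex)" where
  "cscale c v = (\<lambda>n. c * v n)"

interpretation cseq: vector_space cscale
  by unfold_locales (auto simp: cscale_def algebra_simps fun_eq_iff)

definition ell2 :: "(nat \<Rightarrow> complex) set" where
  "ell2 = {v. summable (\<lambda>n. (norm (v n))\<^sup>2)}"

definition ell2_norm :: "(nat \<Rightarrow> complex) \<Rightarrow> real" where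
  "ell2_norm v = sqrt (\<Sum>n. (norm (v n))\<^sup>2)"

definition bounded_operator_ell2 :: "((nat \<Rightarrow> complex) \<Rightarrow> (nat \<Rightarrow> complex)) \<Rightarrow> bool" where
  "bounded_operator_ell2 A \<longleftrightarrow>
     A ` ell2 \<subseteq> ell2 \<and>
     (\<forall>u\<in>ell2. \<forall>v\<in>ell2. A (u + v) = A u + A v) \<and>
     (\<forall>c. \<forall>u\<in>ell2. A (cscale c u) = cscale c (A u)) \<and>
     (\<exists>C. \<forall>u\<in>ell2. ell2_norm (A u) \<le> C * ell2_norm u)"

text \<open>The last conjunct says that the quotient of \<open>ell2\<close> by the range of \<open>A\<close> is
  finite-dimensional. For bounded operators this forces the range to be closed, so closedness
  is not listed separately.\<close>

definition fredholm_ell2 :: "((nat \<Rightarrow> complex) \<Rightarrow> (nat \<Rightarrow> complex)) \<Rightarrow> bool" where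
  "fredholm_ell2 A \<longleftrightarrow>
     bounded_operator_ell2 A \<and>
     (\<exists>K. finite K \<and> {v \<in> ell2. A v = 0} \<subseteq> cseq.span K) \<and>
     (\<exists>W. finite W \<and> W \<subseteq> ell2 \<and> (\<forall>w\<in>ell2. \<exists>u\<in>ell2. w - A u \<in> cseq.span W))"

definition ess_spectrum :: "((nat \<Rightarrow> complex) \<Rightarrow> (nat \<Rightarrow> complex)) \<Rightarrow> complex set" where
  "ess_spectrum A = {lam. \<not> fredholm_ell2 (\<lambda>v. A v - cscale lam v)}"

definition exp_decaying :: "(nat \<Rightarrow> complex) \<Rightarrow> bool" where
  "exp_decaying v \<longleftrightarrow> (\<exists>C r. 0 < r \<and> r < 1 \<and> (\<forall>n. norm (v n) \<le> C * r ^ n))"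

definition edge_eigenvalue :: "((nat \<Rightarrow> complex) \<Rightarrow> (nat \<Rightarrow> complex)) \<Rightarrow> complex \<Rightarrow> bool" where
  "edge_eigenvalue A lam \<longleftrightarrow>
     lam \<notin> ess_spectrum A \<and>
     (\<exists>v\<in>ell2. v \<noteq> 0 \<and> exp_decaying v \<and> A v = cscale lam v)"

text \<open>Because of the index shift, even positions carry \<open>a\<^sub>1, b\<^sub>1\<close> and odd ones \<open>a\<^sub>2, b\<^sub>2\<close>.\<close>

definition per2 :: "complex \<Rightarrow> complex \<Rightarrow> nat \<Rightarrow> complex" where
  "per2 x1 x2 n = (if even n then x1 else x2)"

definition T_entry ::
  "complex \<Rightarrow> complex \<Rightarrow> complex \<Rightarrow> complex \<Rightarrow> nat \<Rightarrow> nat \<Rightarrow> complex" where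
  "T_entry a1 a2 b1 b2 i j =
     (if i = j then per2 a1 a2 i
      else if j = Suc i then per2 b1 b2 i
      else if i = Suc j then per2 b1 b2 j
      else 0)"

definition toeplitz ::
  "complex \<Rightarrow> complex \<Rightarrow> complex \<Rightarrow> complex \<Rightarrow> (nat \<Rightarrow> complex) \<Rightarrow> (nat \<Rightarrow> complex)" where
  "toeplitz a1 a2 b1 b2 v = (\<lambda>i. \<Sum>j. T_entry a1 a2 b1 b2 i j * v j)"

definition symbol ::
  "complex \<Rightarrow> complex \<Rightarrow> complex \<Rightarrow> complex \<Rightarrow> complex \<Rightarrow> complex mat" where
  "symbol a1 a2 b1 b2 z =
     mat_of_rows_list 2 [[a1, b1 + b2 * z], [b1 + b2 * inverse z, a2]]"

definition J_mat :: "complex mat" where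
  "J_mat = mat_of_rows_list 2 [[0, 1], [1, 0]]"

definition persymmetric :: "(complex \<Rightarrow> complex mat) \<Rightarrow> bool" where
  "persymmetric f \<longleftrightarrow> (\<forall>z. norm z = 1 \<longrightarrow> f z = J_mat * transpose_mat (f z) * J_mat)"

text \<open>Multiplicity is algebraic: the order of the root of the characteristic polynomial.\<close>

definition band_gap_closes :: "(complex \<Rightarrow> complex mat) \<Rightarrow> bool" where
  "band_gap_closes f \<longleftrightarrow>
     (\<exists>z mu. norm z = 1 \<and> eigenvalue (f z) mu \<and> order mu (char_poly (f z)) = 2)"

definition topologically_protected ::
  "complex \<Rightarrow> complex \<Rightarrow> complex \<Rightarrow> complex \<Rightarrow> bool" where
  "topologically_protected a1 a2 b1 b2 \<longleftrightarrow>
     (\<forall>(p1 :: real \<Rightarrow> complex) p2 q1 q2.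
        continuous_on {0..1} p1 \<longrightarrow> continuous_on {0..1} p2 \<longrightarrow>
        continuous_on {0..1} q1 \<longrightarrow> continuous_on {0..1} q2 \<longrightarrow>
        (\<forall>t\<in>{0..1}. q1 t \<noteq> 0 \<and> q2 t \<noteq> 0) \<longrightarrow>
        (\<forall>t\<in>{0..1}. persymmetric (symbol (p1 t) (p2 t) (q1 t) (q2 t))) \<longrightarrow>
        symbol (p1 0) (p2 0) (q1 0) (q2 0) = symbol a1 a2 b1 b2 \<longrightarrow>
        (\<forall>t\<in>{0..1}. \<not> band_gap_closes (symbol (p1 t) (p2 t) (q1 t) (q2 t))) \<longrightarrow>
        (\<forall>t\<in>{0..1}.
           p1 t \<notin> ess_spectrum (toeplitz (p1 t) (p2 t) (q1 t) (q2 t)) \<and>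
           edge_eigenvalue (toeplitz (p1 t) (p2 t) (q1 t) (q2 t)) (p1 t)))"

definition B0_mat :: "complex \<Rightarrow> complex \<Rightarrow> complex \<Rightarrow> complex \<Rightarrow> complex mat" where
  "B0_mat a1 a2 b1 b2 = mat 1 1 (\<lambda>(i, j). T_entry a1 a2 b1 b2 i j)"

lemma eigenvalue_B0: "{lam. eigenvalue (B0_mat a1 a2 b1 b2) lam} = {a1}"
proof -
  have c: "B0_mat a1 a2 b1 b2 \<in> carrier_mat 1 1" by (simp add: B0_mat_def)
  have "det (char_matrix (B0_mat a1 a2 b1 b2) lam) = a1 - lam" for lam
    by (subst det_single)
      (auto simp: char_matrix_def B0_mat_def T_entry_def per2_def)
  then show ?thesis
    by (auto simp: eigenvalue_det[OF c])
qed

lemma toeplitz_apply: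
  "toeplitz a1 a2 b1 b2 v n =
     (if n = 0 then 0 else per2 b1 b2 (n - 1) * v (n - 1))
     + per2 a1 a2 n * v n + per2 b1 b2 n * v (Suc n)"
proof -
  have "toeplitz a1 a2 b1 b2 v n = (\<Sum>j\<in>{n - 1, n, Suc n}. T_entry a1 a2 b1 b2 n j * v j)"
    unfolding toeplitz_def by (rule suminf_finite) (auto simp: T_entry_def)
  then show ?thesis
    by (cases n) (auto simp: T_entry_def algebra_simps)
qed

lemma persymmetric_symbol_iff: "persymmetric (symbol a1 a2 b1 b2) \<longleftrightarrow> a1 = a2"
proof -
  have "symbol a1 a2 b1 b2 z = J_mat * transpose_mat (symbol a1 a2 b1 b2 z) * J_mat \<longleftrightarrow> a1 = a2" for z
  proof -
    have *: "J_mat * transpose_mat (symbol a1 a2 b1 b2 z) * J_mat = symbol a2 a1 b1 b2 z"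
      by (rule eq_matI)
        (auto simp: J_mat_def symbol_def mat_of_rows_list_def scalar_prod_def numeral_2_eq_2
           less_Suc_eq)
    have "symbol a1 a2 b1 b2 z = symbol a2 a1 b1 b2 z \<Longrightarrow> a1 = a2"
      by (drule arg_cong[of _ _ "\<lambda>M. M $$ (0,0)"]) (simp add: symbol_def mat_of_rows_list_def)
    then show ?thesis unfolding * by auto
  qed
  then show ?thesis
    unfolding persymmetric_def by (metis norm_one)
qed

lemma bounded_operator_toeplitz: "bounded_operator_ell2 (toeplitz a1 a2 b1 b2)"
proof -
  define T where "T = toeplitz a1 a2 b1 b2"
  define M where "M = norm a1 + norm a2 + norm b1 + norm b2"
  have M0: "0 \<le> M" by (simp add: M_def)
  have per: "norm (per2 a1 a2 n) \<le> M" "norm (per2 b1 b2 n) \<le> M" for n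
    by (auto simp: per2_def M_def intro: add_increasing add_increasing2)
  define sh where "sh v n = (if n = 0 then 0 else v (n - 1))" for v :: "nat \<Rightarrow> real" and n
  define N where "N u n = (norm (u n))\<^sup>2" for u :: "nat \<Rightarrow> complex" and n :: nat
  have pt: "N (T u) n \<le> 3 * M\<^sup>2 * (sh (N u) n + N u n + N u (Suc n))" for u n
  proof -
    define x where "x = (if n = 0 then 0 else norm (u (n - 1)))"
    have "norm (T u n) \<le> norm (if n = 0 then 0 else per2 b1 b2 (n - 1) * u (n - 1))
        + norm (per2 a1 a2 n * u n) + norm (per2 b1 b2 n * u (Suc n))"
      unfolding T_def toeplitz_apply by (intro order_trans[OF norm_triangle_ineq] add_mono) auto
    also have "\<dots> \<le> M * x + M * norm (u n) + M * norm (u (Suc n))"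
      by (intro add_mono) (auto simp: norm_mult x_def per intro!: mult_right_mono)
    finally have "norm (T u n) \<le> M * (x + norm (u n) + norm (u (Suc n)))"
      by (simp add: algebra_simps)
    then have "N (T u) n \<le> (M * (x + norm (u n) + norm (u (Suc n))))\<^sup>2"
      unfolding N_def by (rule power_mono) simp
    also have "\<dots> \<le> M\<^sup>2 * (3 * (x\<^sup>2 + (norm (u n))\<^sup>2 + (norm (u (Suc n)))\<^sup>2))"
    proof -
      have "(p + q + r)\<^sup>2 \<le> 3 * (p\<^sup>2 + q\<^sup>2 + r\<^sup>2)" for p q r :: real
        using sum_squares_bound[of p q] sum_squares_bound[of p r] sum_squares_bound[of q r]
        by (simp add: power2_eq_square algebra_simps)
      then show ?thesis unfolding power_mult_distrib by (intro mult_left_mono) auto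
    qed
    also have "\<dots> = 3 * M\<^sup>2 * (sh (N u) n + N u n + N u (Suc n))"
      by (auto simp: x_def sh_def N_def)
    finally show ?thesis .
  qed
  have bd: "T u \<in> ell2 \<and> ell2_norm (T u) \<le> 3 * M * ell2_norm u" if "u \<in> ell2" for u
  proof -
    have s: "summable (N u)" using that by (simp add: ell2_def N_def[abs_def])
    have Nn: "N u n \<ge> 0" for n by (simp add: N_def)
    have s1: "sh (N u) sums suminf (N u)"
      using sums_Suc_iff[of "sh (N u)" "suminf (N u)"] s by (simp add: sh_def summable_sums)
    have s2: "summable (\<lambda>n. N u (Suc n))" using s by (simp add: summable_Suc_iff)
    have le2: "(\<Sum>n. N u (Suc n)) \<le> suminf (N u)"
      using suminf_split_head[OF s] Nn[of 0] by linarith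
    have S: "summable (\<lambda>n. 3 * M\<^sup>2 * (sh (N u) n + N u n + N u (Suc n)))"
      using s1 s s2 by (intro summable_mult summable_add) (auto simp: sums_iff)
    have sT: "summable (N (T u))"
      by (rule summable_comparison_test'[OF S, of 0]) (use pt in \<open>auto simp: N_def\<close>)
    have "suminf (N (T u)) \<le> (\<Sum>n. 3 * M\<^sup>2 * (sh (N u) n + N u n + N u (Suc n)))"
      by (intro suminf_le pt sT S)
    also have "\<dots> = 3 * M\<^sup>2 * (suminf (N u) + suminf (N u) + (\<Sum>n. N u (Suc n)))"
      using s1 s s2 by (simp add: suminf_mult suminf_add[symmetric] summable_add sums_iff)
    also have "\<dots> \<le> 3 * M\<^sup>2 * (3 * suminf (N u))"
      using le2 by (intro mult_left_mono) auto
    finally have "suminf (N (T u)) \<le> (3 * M)\<^sup>2 * suminf (N u)"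
      by (simp add: power_mult_distrib)
    then have "sqrt (suminf (N (T u))) \<le> 3 * M * sqrt (suminf (N u))"
      using M0 by (metis real_sqrt_le_mono real_sqrt_mult real_sqrt_unique
          mult_nonneg_nonneg zero_le_numeral)
    then show ?thesis using sT by (simp add: ell2_def ell2_norm_def N_def[abs_def])
  qed
  show ?thesis
    unfolding bounded_operator_ell2_def T_def[symmetric]
  proof (intro conjI)
    show "T ` ell2 \<subseteq> ell2" using bd by auto
    show "\<exists>C. \<forall>u\<in>ell2. ell2_norm (T u) \<le> C * ell2_norm u" using bd by blast
    show "\<forall>u\<in>ell2. \<forall>v\<in>ell2. T (u + v) = T u + T v"
      by (auto simp: fun_eq_iff T_def toeplitz_apply algebra_simps)
    show "\<forall>c. \<forall>u\<in>ell2. T (cscale c u) = cscale c (T u)"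
      by (auto simp: fun_eq_iff T_def toeplitz_apply cscale_def algebra_simps)
  qed
qed

end

theory Submission
  imports Defs
begin

text \<open>Persymmetry makes the diagonal of \<open>T(f) - a\<^sub>1\<close> vanish, so this operator maps even
  positions to odd ones and conversely, and is governed by two scalar first-order recurrences
  of ratio \<open>-b\<^sub>1/b\<^sub>2\<close>. The only candidate for an eigenvector is \<open>v\<^sub>2\<^sub>m = (-b\<^sub>1/b\<^sub>2)\<^sup>m\<close>,
  supported on the even positions, hence \<open>a\<^sub>1\<close> is an edge eigenvalue iff \<open>|b\<^sub>1| < |b\<^sub>2|\<close>:
  in that case one recurrence is solved forwards and the other backwards, up to a multiple
  of the first unit vector, which gives the Fredholm property. Since the band gap closes iff
  \<open>|b\<^sub>1| = |b\<^sub>2|\<close>, the intermediate value theorem preserves the strict inequality along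
  the family.\<close>

section \<open>Square-summable sequences and their even and odd parts\<close>

definition unit0 :: "nat \<Rightarrow> complex" where
  "unit0 n = (if n = 0 then 1 else 0)"

definition edge_vector :: "complex \<Rightarrow> nat \<Rightarrow> complex" where
  "edge_vector rho n = (if even n then rho ^ (n div 2) else 0)"

definition interleave :: "(nat \<Rightarrow> 'a) \<Rightarrow> (nat \<Rightarrow> 'a) \<Rightarrow> nat \<Rightarrow> 'a" where
  "interleave x y n = (if even n then x (n div 2) else y (n div 2))"

lemma interleave_simps [simp]:
  "interleave x y 0 = x 0"
  "interleave x y (2 * m) = x m"
  "interleave x y (Suc (2 * m)) = y m"
  by (auto simp: interleave_def)

text \<open>The cases match the three row shapes of \<open>toeplitz_zero_diagonal_rows\<close>: row
  0 has no left neighbour and stands apart from the other even rows.\<close>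

lemma nat_parity_cases:
  obtains "n = 0" | m where "n = Suc (2 * m)" | m where "n = Suc (Suc (2 * m))"
proof (cases "even n")
  case True
  then obtain k where k: "n = 2 * k" by blast
  show thesis
    using k that by (cases k) auto
next
  case False
  then show thesis using that(2) by (metis oddE Suc_eq_plus1)
qed

lemma ell2_interleave:
  assumes "x \<in> ell2" "y \<in> ell2"
  shows "interleave x y \<in> ell2"
proof -
  have "summable (\<lambda>n. if even n then (norm (x (n div 2)))\<^sup>2 else (norm (y ((n - 1) div 2)))\<^sup>2)"
    using assms sums_if[of "\<lambda>n. (norm (y n))\<^sup>2" _ "\<lambda>n. (norm (x n))\<^sup>2"]
    unfolding ell2_def summable_def by blast
  \<comment> \<open>\<open>sums_if\<close> writes the index at odd places as
    \<open>(n - 1) div 2\<close>, which equals \<open>n div 2\<close> there.\<close>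
  also have "(\<lambda>n. if even n then (norm (x (n div 2)))\<^sup>2 else (norm (y ((n - 1) div 2)))\<^sup>2)
      = (\<lambda>n. (norm (interleave x y n))\<^sup>2)"
    by (auto simp: fun_eq_iff interleave_def elim!: oddE)
  finally show ?thesis by (simp add: ell2_def)
qed

lemma ell2_subseq:
  assumes "w \<in> ell2" "inj g"
  shows "(\<lambda>n. w (g n)) \<in> ell2"
  using summable_reindex[of "\<lambda>n. (norm (w n))\<^sup>2" g] assms by (simp add: ell2_def o_def)

lemma ell2_scale: "v \<in> ell2 \<Longrightarrow> (\<lambda>n. c * v n) \<in> ell2"
  by (simp add: ell2_def norm_mult power_mult_distrib summable_mult)

lemma ell2_tendsto_0:
  assumes "v \<in> ell2"
  shows "v \<longlonglongrightarrow> 0"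
proof -
  have "(\<lambda>n. (norm (v n))\<^sup>2) \<longlonglongrightarrow> 0"
    using assms unfolding ell2_def by (blast intro: summable_LIMSEQ_zero)
  then have "(\<lambda>n. sqrt ((norm (v n))\<^sup>2)) \<longlonglongrightarrow> sqrt 0"
    by (rule tendsto_real_sqrt)
  then show ?thesis by (simp add: tendsto_norm_zero_iff)
qed

section \<open>First-order recurrences with a contracting ratio\<close>

text \<open>Convexity of the square, with weights \<open>r\<close> and \<open>1 - r\<close>.\<close>

lemma square_contraction:
  fixes x y g :: real
  assumes "0 \<le> r" "r < 1" "0 \<le> x" "x \<le> r * y + g"
  shows "x\<^sup>2 \<le> r * y\<^sup>2 + g\<^sup>2 / (1 - r)"
proof -
  \<comment> \<open>This choice turns \<open>r * y + g\<close> into the convex combination of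
    \<open>y\<close> and \<open>k\<close>.\<close>
  define k where "k = g / (1 - r)"
  have g: "g = (1 - r) * k" and gk: "g\<^sup>2 / (1 - r) = (1 - r) * k\<^sup>2"
    using assms(2) by (simp_all add: k_def power2_eq_square)
  have "x\<^sup>2 \<le> (r * y + (1 - r) * k)\<^sup>2"
    using assms(3,4) by (intro power_mono) (auto simp: g)
  also have "\<dots> = r * y\<^sup>2 + (1 - r) * k\<^sup>2 - r * (1 - r) * (y - k)\<^sup>2"
    by (simp add: algebra_simps power2_eq_square)
  also have "\<dots> \<le> r * y\<^sup>2 + (1 - r) * k\<^sup>2"
    using assms(1,2) by simp
  finally show ?thesis by (simp only: gk)
qed

text \<open>\<open>square_contraction\<close> turns the recurrence into one for the squared norms
  \<open>X\<close>, with summable source \<open>H\<close>. Summing it and absorbing the multiple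
  \<open>r\<close> of the partial sum into the left side bounds all partial sums.\<close>

lemma ell2_forward_recurrence:
  fixes x g :: "nat \<Rightarrow> complex"
  assumes rho: "norm rho < 1" and g: "g \<in> ell2"
    and x: "\<And>n. x (Suc n) = g n + rho * x n"
  shows "x \<in> ell2"
proof -
  define r where "r = norm rho"
  define X where "X n = (norm (x n))\<^sup>2" for n
  define H where "H n = (norm (g n))\<^sup>2 / (1 - r)" for n
  have r: "0 \<le> r" "r < 1" using rho by (auto simp: r_def)
  have sH: "summable H"
    using g unfolding H_def ell2_def by (intro summable_divide) simp
  have H0: "0 \<le> H n" for n using r by (simp add: H_def)
  have step: "X (Suc n) \<le> r * X n + H n" for n
    unfolding X_def H_def
  proof (rule square_contraction[OF r])
    show "norm (x (Suc n)) \<le> r * norm (x n) + norm (g n)"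
      unfolding x r_def using norm_triangle_ineq[of "g n" "rho * x n"] by (simp add: norm_mult)
  qed simp
  have "summable X"
  proof (rule summableI_nonneg_bounded)
    fix N
    have "(1 - r) * sum X {..<N} \<le> X 0 + sum H {..<N}"
    proof (induction N)
      case (Suc N)
      have "sum X {..<Suc N} = X 0 + (\<Sum>n<N. X (Suc n))"
        by (rule sum.lessThan_Suc_shift)
      also have "(\<Sum>n<N. X (Suc n)) \<le> (\<Sum>n<N. r * X n + H n)"
        by (intro sum_mono step)
      also have "\<dots> = r * sum X {..<N} + sum H {..<N}"
        by (simp add: sum.distrib sum_distrib_left)
      \<comment> \<open>One more nonnegative term gives the same partial sum on both sides.\<close>
      also have "r * sum X {..<N} \<le> r * sum X {..<Suc N}"
        using r by (intro mult_left_mono) (auto simp: X_def)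
      finally show ?case using H0[of N] by (simp add: algebra_simps)
    qed (simp add: X_def)
    also have "sum H {..<N} \<le> suminf H"
      by (rule sum_le_suminf[OF sH]) (auto simp: H0)
    finally show "sum X {..<N} \<le> (X 0 + suminf H) / (1 - r)"
      using r by (simp add: field_simps)
  qed (simp add: X_def)
  then show ?thesis by (simp add: ell2_def X_def[abs_def])
qed

text \<open>Stepping upwards in \<open>n\<close> would divide by \<open>rho\<close>. Unrolling the
  recurrence instead gives a series in \<open>rho ^ k * g (n + k)\<close>, which converges because
  \<open>g\<close> is bounded.\<close>

lemma ell2_backward_recurrence:
  fixes g :: "nat \<Rightarrow> complex"
  assumes rho: "norm rho < 1" and g: "g \<in> ell2"
  obtains y where "y \<in> ell2" "\<And>n. y n = g n + rho * y (Suc n)"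
proof -
  define r where "r = norm rho"
  have r: "0 \<le> r" "r < 1" using rho by (auto simp: r_def)
  obtain B where B: "\<And>n. norm (g n) \<le> B"
    using convergent_imp_Bseq[OF convergentI[OF ell2_tendsto_0[OF g]]]
    by (auto simp: Bseq_def)
  define y where "y n = (\<Sum>k. rho ^ k * g (n + k))" for n
  have bd: "norm (rho ^ k * g (n + k)) \<le> B * r ^ k" for n k
    using mult_right_mono[OF B[of "n + k"], of "r ^ k"] r
    by (simp add: norm_mult norm_power r_def mult.commute)
  have sB: "summable (\<lambda>k. B * r ^ k)"
    using r by (intro summable_mult summable_geometric) auto
  have sy: "summable (\<lambda>k. rho ^ k * g (n + k))" for n
    by (rule summable_comparison_test'[OF sB, of 0]) (rule bd)
  have rec: "y n = g n + rho * y (Suc n)" for n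
  proof -
    have "(\<lambda>k. rho * (rho ^ k * g (Suc n + k))) = (\<lambda>k. rho ^ Suc k * g (n + Suc k))"
      by (simp add: fun_eq_iff)
    then have "rho * y (Suc n) = (\<Sum>k. rho ^ Suc k * g (n + Suc k))"
      unfolding y_def by (simp only: suminf_mult[OF sy, symmetric])
    then show ?thesis
      using suminf_split_head[OF sy[of n]] by (simp add: y_def)
  qed
  \<comment> \<open>Summing the shifted squares below leaves a boundary term \<open>Y N\<close>; a
    bound on \<open>y\<close> uniform in \<open>n\<close> controls it.\<close>
  define C where "C = (\<Sum>k. B * r ^ k)"
  have yC: "norm (y n) \<le> C" for n
    unfolding y_def C_def by (rule norm_suminf_le[OF bd sB])
  define Y where "Y n = (norm (y n))\<^sup>2" for n
  define H where "H n = (norm (g n))\<^sup>2 / (1 - r)" for n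
  have sH: "summable H"
    using g unfolding H_def ell2_def by (intro summable_divide) simp
  have H0: "0 \<le> H n" for n using r by (simp add: H_def)
  have step: "Y n \<le> r * Y (Suc n) + H n" for n
    unfolding Y_def H_def
  proof (rule square_contraction[OF r])
    show "norm (y n) \<le> r * norm (y (Suc n)) + norm (g n)"
      unfolding rec[of n] r_def using norm_triangle_ineq[of "g n" "rho * y (Suc n)"]
      by (simp add: norm_mult)
  qed simp
  have "summable Y"
  proof (rule summableI_nonneg_bounded)
    fix N
    have "sum Y {..<N} \<le> (\<Sum>n<N. r * Y (Suc n) + H n)"
      by (intro sum_mono step)
    also have "\<dots> = r * (\<Sum>n<N. Y (Suc n)) + sum H {..<N}"
      by (simp add: sum.distrib sum_distrib_left)
    also have "(\<Sum>n<N. Y (Suc n)) = sum Y {..<N} + Y N - Y 0"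
      using sum.lessThan_Suc_shift[of Y N] by simp
    also have "r * (sum Y {..<N} + Y N - Y 0) \<le> r * (sum Y {..<N} + C\<^sup>2)"
    proof (rule mult_left_mono[OF _ r(1)])
      have "Y N \<le> C\<^sup>2" "0 \<le> Y 0"
        unfolding Y_def by (auto intro: power_mono yC)
      then show "sum Y {..<N} + Y N - Y 0 \<le> sum Y {..<N} + C\<^sup>2" by linarith
    qed
    also have "sum H {..<N} \<le> suminf H"
      by (rule sum_le_suminf[OF sH]) (auto simp: H0)
    finally show "sum Y {..<N} \<le> (r * C\<^sup>2 + suminf H) / (1 - r)"
      using r by (simp add: field_simps)
  qed (simp add: Y_def)
  then have "y \<in> ell2" by (simp add: ell2_def Y_def[abs_def])
  then show thesis using rec that by blast
qed

section \<open>The operator with zero diagonal and its kernel\<close>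

lemma toeplitz_minus_diagonal:
  "toeplitz a a b1 b2 v - cscale a v = toeplitz 0 0 b1 b2 v"
  by (auto simp: fun_eq_iff toeplitz_apply cscale_def per2_def)

lemma toeplitz_zero_diagonal_rows:
  "toeplitz 0 0 b1 b2 v 0 = b1 * v 1"
  "toeplitz 0 0 b1 b2 v (Suc (2 * m)) = b1 * v (2 * m) + b2 * v (2 * Suc m)"
  "toeplitz 0 0 b1 b2 v (Suc (Suc (2 * m))) = b2 * v (Suc (2 * m)) + b1 * v (Suc (2 * Suc m))"
  by (simp_all add: toeplitz_apply per2_def)

text \<open>The odd rows carry \<open>v 0\<close> along the even positions; row 0 forces
  \<open>v 1 = 0\<close>, and the later even rows carry this zero along the odd positions. The
  argument covers all sequences, not only those in \<open>ell2\<close>.\<close>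

lemma toeplitz_zero_diagonal_kernel:
  assumes "b1 \<noteq> 0" "b2 \<noteq> 0" "toeplitz 0 0 b1 b2 v = 0"
  shows "v = cscale (v 0) (edge_vector (- b1 / b2))"
proof -
  note rows = toeplitz_zero_diagonal_rows[of b1 b2 v, unfolded assms(3)]
  have ev: "v (2 * m) = v 0 * (- b1 / b2) ^ m" for m
  proof (induction m)
    case (Suc m)
    have "b2 * v (2 * Suc m) = - b1 * v (2 * m)"
      using rows(2)[of m] by (simp add: eq_neg_iff_add_eq_0 add.commute)
    then have "v (2 * Suc m) = (- b1 / b2) * v (2 * m)"
      using assms(2) by (simp add: field_simps)
    then show ?case by (simp add: Suc.IH)
  qed simp
  have od: "v (Suc (2 * m)) = 0" for m
  proof (induction m)
    case 0
    then show ?case using rows(1) assms(1) by simp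
  next
    case (Suc m)
    then show ?case using rows(3)[of m] assms(1) by simp
  qed
  show ?thesis
  proof
    fix n
    show "v n = cscale (v 0) (edge_vector (- b1 / b2)) n"
      using ev[of "n div 2"] od[of "n div 2"]
      by (cases "even n") (auto simp: cscale_def edge_vector_def)
  qed
qed

lemma toeplitz_zero_diagonal_edge_vector:
  assumes "b2 \<noteq> 0"
  shows "toeplitz 0 0 b1 b2 (edge_vector (- b1 / b2)) = 0"
proof
  fix n
  define rho where "rho = - b1 / b2"
  \<comment> \<open>The factor \<open>c\<close> stands for the power of \<open>rho\<close> left over
    in an odd row.\<close>
  have rho: "b2 * (rho * c) = - (b1 * c)" for c
    using assms by (simp add: rho_def)
  have "toeplitz 0 0 b1 b2 (edge_vector rho) n = 0"
    by (cases n rule: nat_parity_cases)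
      (simp_all add: toeplitz_zero_diagonal_rows edge_vector_def rho)
  then show "toeplitz 0 0 b1 b2 (edge_vector (- b1 / b2)) n = 0 n"
    by (simp add: rho_def)
qed

section \<open>Square summability and decay of the edge vector\<close>

lemma geometric_ell2_iff: "(\<lambda>m. rho ^ m) \<in> ell2 \<longleftrightarrow> norm rho < 1"
proof -
  have "(norm (rho ^ m))\<^sup>2 = ((norm rho)\<^sup>2) ^ m" for m
    by (simp add: norm_power power_mult[symmetric] mult.commute)
  then show ?thesis
    by (simp add: ell2_def abs_square_less_1)
qed

lemma edge_vector_ell2_iff: "edge_vector rho \<in> ell2 \<longleftrightarrow> norm rho < 1"
proof
  assume "edge_vector rho \<in> ell2"
  then have "(\<lambda>m. edge_vector rho (2 * m)) \<in> ell2"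
    by (rule ell2_subseq) (simp add: inj_def)
  then show "norm rho < 1" by (simp add: edge_vector_def geometric_ell2_iff)
next
  assume "norm rho < 1"
  moreover have "(\<lambda>n. 0) \<in> ell2" by (simp add: ell2_def)
  ultimately show "edge_vector rho \<in> ell2"
    using ell2_interleave[of "\<lambda>m. rho ^ m" "\<lambda>_. 0"]
    by (simp add: interleave_def[abs_def] edge_vector_def[abs_def] geometric_ell2_iff)
qed

text \<open>Position \<open>2m\<close> carries only the \<open>m\<close>-th power of \<open>\<rho>\<close>, hence the square root in the rate;
  averaging with 1 keeps the rate positive for \<open>\<rho> = 0\<close>.\<close>

lemma exp_decaying_edge_vector:
  assumes "norm rho < 1"
  shows "exp_decaying (edge_vector rho)"
proof -
  define s where "s = sqrt ((1 + norm rho) / 2)"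
  have pos: "0 < (1 + norm rho) / 2"
    by (simp add: add_pos_nonneg)
  have s: "0 < s" "s < 1" using pos assms by (auto simp: s_def)
  have s2: "s\<^sup>2 = (1 + norm rho) / 2" using pos by (simp add: s_def)
  have "norm (edge_vector rho n) \<le> 1 * s ^ n" for n
  proof (cases "even n")
    case True
    then obtain m where m: "n = 2 * m" by blast
    have "norm rho ^ m \<le> (s\<^sup>2) ^ m"
      using assms by (intro power_mono) (auto simp: s2)
    then show ?thesis by (simp add: m edge_vector_def norm_power power_mult)
  next
    case False
    then show ?thesis using s by (simp add: edge_vector_def)
  qed
  then show ?thesis unfolding exp_decaying_def using s by blast
qed

section \<open>Fredholm property and criterion for an edge eigenvalue\<close>

lemma fredholm_toeplitz_zero_diagonal:
  assumes b1: "b1 \<noteq> 0" and lt: "norm b1 < norm b2"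
  shows "fredholm_ell2 (toeplitz 0 0 b1 b2)"
  unfolding fredholm_ell2_def
proof (intro conjI)
  have b2: "b2 \<noteq> 0" using lt by auto
  define rho where "rho = - b1 / b2"
  have rho: "norm rho < 1" using lt b2 by (simp add: rho_def norm_divide)
  show "bounded_operator_ell2 (toeplitz 0 0 b1 b2)" by (rule bounded_operator_toeplitz)
  have "v \<in> cseq.span {edge_vector rho}" if "toeplitz 0 0 b1 b2 v = 0" for v
    by (subst toeplitz_zero_diagonal_kernel[OF b1 b2 that])
      (simp add: rho_def cseq.span_scale cseq.span_base)
  then have "{v \<in> ell2. toeplitz 0 0 b1 b2 v = 0} \<subseteq> cseq.span {edge_vector rho}" by blast
  then show "\<exists>K. finite K \<and> {v \<in> ell2. toeplitz 0 0 b1 b2 v = 0} \<subseteq> cseq.span K" by blast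
  have "\<exists>u\<in>ell2. w - toeplitz 0 0 b1 b2 u \<in> cseq.span {unit0}" if w: "w \<in> ell2" for w
  proof -
    \<comment> \<open>Divided by \<open>b2\<close>, the odd rows form a forward recurrence for the
      even entries \<open>x\<close> with source \<open>g\<close>, and the even rows after row 0 a
      backward recurrence for the odd entries \<open>y\<close> with source \<open>h\<close>.\<close>
    define g where "g m = inverse b2 * w (Suc (2 * m))" for m
    define h where "h m = inverse b2 * w (Suc (Suc (2 * m)))" for m
    have g: "g \<in> ell2"
      unfolding g_def by (rule ell2_scale[OF ell2_subseq[OF w]]) (simp add: inj_def)
    have h: "h \<in> ell2"
      unfolding h_def by (rule ell2_scale[OF ell2_subseq[OF w]]) (simp add: inj_def)
    \<comment> \<open>The initial value is free: changing it adds a multiple of the kernel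
      vector.\<close>
    define x where "x = rec_nat 0 (\<lambda>m xm. g m + rho * xm)"
    have x: "x (Suc m) = g m + rho * x m" for m by (simp add: x_def)
    have x2: "x \<in> ell2" by (rule ell2_forward_recurrence[OF rho g x])
    obtain y where y2: "y \<in> ell2" and y: "\<And>m. y m = h m + rho * y (Suc m)"
      using ell2_backward_recurrence[OF rho h] by blast
    \<comment> \<open>Row 0 would require \<open>b1 * y 0 = w 0\<close>, but \<open>y\<close> is
      already chosen; the defect is the coefficient of \<open>unit0\<close>.\<close>
    have "w - toeplitz 0 0 b1 b2 (interleave x y) = cscale (w 0 - b1 * y 0) unit0"
    proof
      fix n
      show "(w - toeplitz 0 0 b1 b2 (interleave x y)) n = cscale (w 0 - b1 * y 0) unit0 n"
      proof (cases n rule: nat_parity_cases)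
        case 1
        then show ?thesis
          using interleave_simps(3)[of x y 0]
          by (simp add: toeplitz_zero_diagonal_rows cscale_def unit0_def)
      next
        case (2 m)
        have "b2 * x (Suc m) = w n - b1 * x m"
          unfolding x g_def rho_def using b2 2 by (simp add: field_simps)
        \<comment> \<open>Without \<open>mult_Suc_right\<close> the index \<open>2 * Suc m\<close>
          stays intact and \<open>interleave_simps\<close> applies to it.\<close>
        then show ?thesis
          by (simp add: 2 toeplitz_zero_diagonal_rows cscale_def unit0_def del: mult_Suc_right)
      next
        case (3 m)
        have "b2 * y m = w n - b1 * y (Suc m)"
          unfolding y[of m] h_def rho_def using b2 3 by (simp add: field_simps)
        then show ?thesis
          by (simp add: 3 toeplitz_zero_diagonal_rows cscale_def unit0_def del: mult_Suc_right)
      qed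
    qed
    then have "w - toeplitz 0 0 b1 b2 (interleave x y) \<in> cseq.span {unit0}"
      by (simp add: cseq.span_scale cseq.span_base)
    then show ?thesis using ell2_interleave[OF x2 y2] by blast
  qed
  moreover have "unit0 \<in> ell2"
    unfolding ell2_def by (auto intro!: summable_finite[of "{0}"] simp: unit0_def split: if_splits)
  ultimately show "\<exists>W. finite W \<and> W \<subseteq> ell2 \<and>
      (\<forall>w\<in>ell2. \<exists>u\<in>ell2. w - toeplitz 0 0 b1 b2 u \<in> cseq.span W)"
    by (intro exI[of _ "{unit0}"]) auto
qed

text \<open>After subtracting \<open>a\<close>, every eigenvector is a nonzero multiple of the edge
  vector, so its square summability forces the inequality. Conversely, the inequality makes the edge
  vector decay and the shifted operator Fredholm.\<close>

lemma edge_eigenvalue_toeplitz_iff: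
  assumes b1: "b1 \<noteq> 0" and b2: "b2 \<noteq> 0"
  shows "edge_eigenvalue (toeplitz a a b1 b2) a \<longleftrightarrow> norm b1 < norm b2"
proof
  have rho: "norm (- b1 / b2) < 1 \<longleftrightarrow> norm b1 < norm b2"
    using b2 by (simp add: norm_divide)
  show "norm b1 < norm b2" if edge: "edge_eigenvalue (toeplitz a a b1 b2) a"
  proof -
    obtain v where v: "v \<in> ell2" "v \<noteq> 0" "toeplitz a a b1 b2 v = cscale a v"
      using edge unfolding edge_eigenvalue_def by blast
    define e where "e = edge_vector (- b1 / b2)"
    have "toeplitz 0 0 b1 b2 v = 0"
      using v(3) toeplitz_minus_diagonal[of a b1 b2 v] by simp
    then have ve: "v = cscale (v 0) e"
      unfolding e_def by (rule toeplitz_zero_diagonal_kernel[OF b1 b2])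
    have v0: "v 0 \<noteq> 0"
    proof
      assume "v 0 = 0"
      then have "v = 0" using ve by (simp add: cscale_def fun_eq_iff)
      then show False using v(2) by simp
    qed
    have "inverse (v 0) * v n = e n" for n
      using v0 by (subst (2) ve) (simp add: cscale_def)
    then have "e \<in> ell2"
      using ell2_scale[OF v(1), of "inverse (v 0)"] by simp
    then show ?thesis
      using edge_vector_ell2_iff[of "- b1 / b2"] rho by (simp add: e_def)
  qed
  show "edge_eigenvalue (toeplitz a a b1 b2) a" if lt: "norm b1 < norm b2"
    unfolding edge_eigenvalue_def
  proof (intro conjI bexI)
    show "a \<notin> ess_spectrum (toeplitz a a b1 b2)"
      using fredholm_toeplitz_zero_diagonal[OF b1 lt]
      by (simp add: ess_spectrum_def toeplitz_minus_diagonal)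
    show "edge_vector (- b1 / b2) \<noteq> 0"
      by (auto simp: fun_eq_iff edge_vector_def intro!: exI[of _ 0])
    show "exp_decaying (edge_vector (- b1 / b2))"
      using lt rho by (intro exp_decaying_edge_vector) blast
    show "toeplitz a a b1 b2 (edge_vector (- b1 / b2)) = cscale a (edge_vector (- b1 / b2))"
      using toeplitz_minus_diagonal[of a b1 b2 "edge_vector (- b1 / b2)"]
        toeplitz_zero_diagonal_edge_vector[OF b2, of b1] by simp
    show "edge_vector (- b1 / b2) \<in> ell2"
      using lt rho edge_vector_ell2_iff by blast
  qed
qed

section \<open>Gap closing and deformation of the symbol\<close>

text \<open>At \<open>z = -b\<^sub>2/b\<^sub>1\<close>, which lies on the unit circle, the symbol is upper triangular.\<close>

lemma band_gap_closes_symbol: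
  assumes "b1 \<noteq> 0" "norm b1 = norm b2"
  shows "band_gap_closes (symbol a a b1 b2)"
proof -
  define z where "z = - b2 / b1"
  define A where "A = symbol a a b1 b2 z"
  have b2: "b2 \<noteq> 0" using assms by (metis norm_eq_zero)
  have z: "norm z = 1" using assms b2 by (simp add: z_def norm_divide)
  have A: "A \<in> carrier_mat 2 2"
    by (simp add: A_def symbol_def mat_of_rows_list_def numeral_2_eq_2)
  have ent: "A $$ (0, 0) = a" "A $$ (1, 0) = 0" "A $$ (1, 1) = a"
    using assms(1) b2 by (simp_all add: A_def symbol_def mat_of_rows_list_def z_def)
  have "upper_triangular A"
    using A ent by (auto simp: upper_triangular_def less_2_cases_iff)
  moreover have "diag_mat A = [a, a]"
    using A ent by (simp add: diag_mat_def numeral_2_eq_2)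
  \<comment> \<open>A double root suffices even where \<open>A\<close> is not diagonalizable, since
    the multiplicity in \<open>band_gap_closes\<close> is algebraic.\<close>
  ultimately have cp: "char_poly A = [:- a, 1:] ^ 2"
    using char_poly_upper_triangular[OF A] by (simp add: power2_eq_square)
  have "eigenvalue A a"
    unfolding eigenvalue_root_char_poly[OF A] cp by simp
  then show ?thesis
    unfolding band_gap_closes_def using z order_power_n_n[of a 2] cp
    by (intro exI[of _ z] exI[of _ a]) (simp add: A_def)
qed

text \<open>The symbols agree for all complex \<open>z\<close>, and the upper right entry is affine
  in \<open>z\<close>; its values at 0 and 1 determine both coefficients.\<close>

lemma symbol_eqD:
  assumes "symbol a1 a2 b1 b2 = symbol c1 c2 d1 d2"
  shows "b1 = d1" "b2 = d2"
proof -
  have "symbol a1 a2 b1 b2 z $$ (0, 1) = symbol c1 c2 d1 d2 z $$ (0, 1)" for z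
    by (simp add: assms)
  then have "b1 + b2 * z = d1 + d2 * z" for z
    by (simp add: symbol_def mat_of_rows_list_def)
  from this[of 0] this[of 1] show "b1 = d1" "b2 = d2" by auto
qed

theorem proposition2p13:
  fixes a1 a2 b1 b2 :: complex
  assumes "b1 \<noteq> 0" and "b2 \<noteq> 0"
    and "persymmetric (symbol a1 a2 b1 b2)"
    and "edge_eigenvalue (toeplitz a1 a2 b1 b2) a1"
  shows "topologically_protected a1 a2 b1 b2"
proof -
  have lt0: "norm b1 < norm b2"
    using assms by (simp add: persymmetric_symbol_iff edge_eigenvalue_toeplitz_iff)
  have "edge_eigenvalue (toeplitz (p1 t) (p2 t) (q1 t) (q2 t)) (p1 t)"
    if c: "continuous_on {0..1} q1" "continuous_on {0..1} q2"
      and nz: "\<forall>t\<in>{0..1}. q1 t \<noteq> 0 \<and> q2 t \<noteq> 0"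
      and per: "\<forall>t\<in>{0..1}. persymmetric (symbol (p1 t) (p2 t) (q1 t) (q2 t))"
      and start: "symbol (p1 0) (p2 0) (q1 0) (q2 0) = symbol a1 a2 b1 b2"
      and gap: "\<forall>t\<in>{0..1}. \<not> band_gap_closes (symbol (p1 t) (p2 t) (q1 t) (q2 t))"
      and t: "t \<in> {0..1}"
    for p1 p2 q1 q2 :: "real \<Rightarrow> complex" and t
  proof -
    \<comment> \<open>By the criterion, \<open>d s < 0\<close> says that \<open>p1 s\<close> is an
      edge eigenvalue; a zero of \<open>d\<close> would close the gap.\<close>
    define d where "d s = norm (q1 s) - norm (q2 s)" for s
    have p: "p1 s = p2 s" if "s \<in> {0..1}" for s
      using per that by (simp add: persymmetric_symbol_iff)
    have d_nz: "d s \<noteq> 0" if "s \<in> {0..1}" for s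
      using band_gap_closes_symbol[of "q1 s" "q2 s" "p1 s"] gap nz p that by (auto simp: d_def)
    have d0: "d 0 < 0"
      using symbol_eqD[OF start] lt0 by (simp add: d_def)
    have "d t < 0"
    proof (rule ccontr)
      assume "\<not> d t < 0"
      \<comment> \<open>If \<open>d t\<close> were nonnegative, \<open>d\<close> would vanish
        somewhere between 0 and \<open>t\<close>.\<close>
      moreover have "continuous_on {0..t} d"
        unfolding d_def using t by (intro continuous_intros continuous_on_subset[OF c(1)]
            continuous_on_subset[OF c(2)]) auto
      ultimately obtain s where "0 \<le> s" "s \<le> t" "d s = 0"
        using IVT'[of d 0 0 t] d0 t by auto
      then show False using d_nz[of s] t by auto
    qed
    then show ?thesis
      using nz t p[OF t] edge_eigenvalue_toeplitz_iff[of "q1 t" "q2 t" "p1 t"]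
      by (auto simp: d_def)
  qed
  \<comment> \<open>The other claim, that \<open>p1 t\<close> avoids the essential spectrum, is a
    conjunct of \<open>edge_eigenvalue\<close>.\<close>
  then show ?thesis
    unfolding topologically_protected_def by (auto simp: edge_eigenvalue_def)
qed

end
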